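(* Let $A\in\mathbb{C}^{n\times n}$ and let $Z$ be the eigenprojection of $A$. Suppose that $\lambda_1,\ldots,\lambda_s$ are the distinct eigenvalues of $A$ (all of them), $\nu_1,\ldots,\nu_s$ are their indices, and the integers $u_1,\ldots,u_s$ are such that $u_i\ge\nu_i$, $i=1,\ldots,s$. Let $u\ge\operatorname{ind}A$ be an integer. Then $$Z=\prod_{i:\,\lambda_i\ne0}\bigl(I-(A/\lambda_i)^u\bigr)^{u_i}$$ and $$Z_{kj}=\prod_{i\ne k}\left(I-\left(\frac{A-\lambda_kI}{\lambda_i-\lambda_k}\right)^{u_k}\right)^{u_i}(j!)^{-1}(A-\lambda_kI)^j,$$ where $Z_{kj}$ is the order $j$ component of $A$ corresponding to $\lambda_k$, $k=1,\ldots,s$, $j=0,\ldots,\nu_k-1$, and the product in the second formula is over $i\in\{1,\ldots,s\}\setminus\{k\}$.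
   Context: For a square matrix $A\in\mathbb{C}^{n\times n}$, $\mathcal{R}(A)$ and $\mathcal{N}(A)$ denote its range and null space. The index $\operatorname{ind}A$ is the smallest $k\in\{0,1,\ldots\}$ such that $\operatorname{rank}A^{k+1}=\operatorname{rank}A^k$ (with $A^0=I$). The eigenprojection of $A$ (corresponding to the eigenvalue $0$) is the unique idempotent matrix $Z\in\mathbb{C}^{n\times n}$ with $\mathcal{R}(Z)=\mathcal{N}(A^\nu)$ and $\mathcal{N}(Z)=\mathcal{R}(A^\nu)$, where $\nu=\operatorname{ind}A$. The index $\nu_k$ of an eigenvalue $\lambda_k$ of $A$ is the order of the greatest Jordan block of $A$ corresponding to $\lambda_k$; equivalently $\nu_k=\operatorname{ind}(A-\lambda_kI)$, the power of the factor $(\lambda-\lambda_k)$ in the minimal polynomial of $A$. The eigenprojection of $A$ corresponding to $\lambda_k$ is the eigenprojection of the matrix $A-\lambda_kI$. The components $Z_{kj}$ of $A$ ($k=1,\ldots,s$, $j=0,\ldots,\nu_k-1$) are the matrices in the representation $f(A)=\sum_{k=1}^s\sum_{j=0}^{\nu_k-1}f^{(j)}(\lambda_k)Z_{kj}$ of functions of $A$, where $f:\mathbb{C}\to\mathbb{C}$ has finite derivatives $f^{(j)}(\lambda_k)$ of the corresponding orders. Explicitly, $Z_{k0}$ is the eigenprojection of $A$ corresponding to $\lambda_k$, and $Z_{kj}=(j!)^{-1}(A-\lambda_kI)^jZ_{k0}$. Empty products of matrices equal the identity matrix $I$, and $X^0=I$ for any square matrix $X$. *)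

theory Defs
  imports
    "Jordan_Normal_Form.Jordan_Normal_Form_Existence"
    "Jordan_Normal_Form.DL_Rank"
    "Jordan_Normal_Form.Matrix_Kernel"
begin

definition mat_range :: "complex mat \<Rightarrow> complex vec set" where
  "mat_range A = (\<lambda>v. A *\<^sub>v v) ` carrier_vec (dim_col A)"

definition mat_index :: "complex mat \<Rightarrow> nat" where
  "mat_index A =
     (LEAST k. vec_space.rank (dim_row A) (A ^\<^sub>m (k + 1)) = vec_space.rank (dim_row A) (A ^\<^sub>m k))"

definition eigenprojection :: "complex mat \<Rightarrow> complex mat" where
  "eigenprojection A =
     (THE Z. Z \<in> carrier_mat (dim_row A) (dim_row A) \<and> Z * Z = Z \<and>
        mat_range Z = mat_kernel (A ^\<^sub>m mat_index A) \<and>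
        mat_kernel Z = mat_range (A ^\<^sub>m mat_index A))"

definition mat_shift :: "complex mat \<Rightarrow> complex \<Rightarrow> complex mat" where
  "mat_shift A l = A - l \<cdot>\<^sub>m 1\<^sub>m (dim_row A)"

(* Order of the greatest Jordan block for l. Jordan forms of A differ only in the order of the
   blocks, so collecting the blocks over all of them changes nothing. Meaningful only if l is an
   eigenvalue of A, since otherwise the set is empty. *)
definition eigenvalue_index :: "complex mat \<Rightarrow> complex \<Rightarrow> nat" where
  "eigenvalue_index A l = Max {m. \<exists>n_as. jordan_nf A n_as \<and> (m, l) \<in> set n_as}"

definition eigenprojection_at :: "complex mat \<Rightarrow> complex \<Rightarrow> complex mat" where
  "eigenprojection_at A l = eigenprojection (mat_shift A l)"

definition mat_component :: "complex mat \<Rightarrow> complex \<Rightarrow> nat \<Rightarrow> complex mat" where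
  "mat_component A l j =
     inverse (fact j) \<cdot>\<^sub>m ((mat_shift A l ^\<^sub>m j) * eigenprojection_at A l)"

(* Product in list order of n x n matrices; the empty product is the identity. *)
definition mat_prod :: "nat \<Rightarrow> complex mat list \<Rightarrow> complex mat" where
  "mat_prod n Ms = foldr (*) Ms (1\<^sub>m n)"

end

theory Submission
  imports Defs
begin

text \<open>
Both formulas are instances of one fact about polynomials in a matrix. Let \<open>S\<close> be annihilated by
\<open>X^N * q\<close> with \<open>q(0) \<noteq> 0\<close>, let \<open>u\<close> be at least the index of \<open>S\<close>, and let \<open>e\<close> be a polynomial that is
divisible by \<open>q\<close> and congruent to \<open>1\<close> modulo \<open>X^u\<close>. Then \<open>e(S)\<close> is the eigenprojection of \<open>S\<close>
(\<open>eigenprojection_eq_mat_poly\<close>). Indeed, with \<open>\<nu>\<close> the index, \<open>S^\<nu> e(S) = 0\<close> and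
\<open>1 - e = X^\<nu> r\<close> for some \<open>r\<close>. The first identity puts the range of \<open>e(S)\<close> inside the kernel of \<open>S^\<nu>\<close>
and the range of \<open>S^\<nu>\<close> inside the kernel of \<open>e(S)\<close>; the second gives \<open>v = e(S) v + S^\<nu> r(S) v\<close>
for every \<open>v\<close>, and with it both converse inclusions; together they make \<open>e(S)\<close> idempotent.

The theorem takes \<open>S = A - l I\<close>, where \<open>l\<close> is \<open>0\<close> or an eigenvalue, and the product over the eigenvalues
\<open>\<mu>_i = \<lambda>_i - l \<noteq> 0\<close> of \<open>S\<close> of the factors \<open>(1 - (X / \<mu>_i)^u)^(u_i)\<close> as \<open>e\<close>. Each factor is
\<open>1\<close> modulo \<open>X^u\<close>. Since \<open>\<mu>_i\<close> is a root of \<open>1 - (X / \<mu>_i)^u\<close>, the factor is divisible by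
\<open>(X - \<mu>_i)^(u_i)\<close>, and the product of these powers is \<open>q\<close>. That \<open>X^N * q\<close> annihilates \<open>S\<close> is read off
the Jordan form: a block of size \<open>m\<close> for \<open>\<lambda>_i\<close> is annihilated by \<open>(X - \<lambda>_i)^m\<close>, and
\<open>m\<close> is at most \<open>u_i\<close> (\<open>mat_poly_annihilator\<close>).

The link between the index, defined by ranks, and annihilating polynomials goes in two directions.
An annihilator \<open>X^N * q\<close> with \<open>q(0) \<noteq> 0\<close> bounds the index by \<open>N\<close> (\<open>mat_index_le\<close>); this lets \<open>u_k\<close>
serve as the exponent in the formula for the components. Conversely the exponent \<open>N\<close> can be lowered
to the index (\<open>mat_poly_index_annihilates\<close>), because the ranges of the powers of \<open>S\<close> stay the same
from the index on.
\<close>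

section \<open>Polynomials in a square matrix\<close>

text \<open>Horner evaluation. As polynomials in one fixed matrix commute, this evaluation moves all
computations with such matrices into the commutative ring of polynomials.\<close>

definition mat_poly :: "'a::comm_ring_1 poly \<Rightarrow> 'a mat \<Rightarrow> 'a mat" where
  "mat_poly p A =
     fold_coeffs (\<lambda>a M. a \<cdot>\<^sub>m 1\<^sub>m (dim_row A) + A * M) p (0\<^sub>m (dim_row A) (dim_row A))"

lemma mat_poly_0: "mat_poly 0 A = 0\<^sub>m (dim_row A) (dim_row A)"
  by (simp add: mat_poly_def)

lemma mat_poly_pCons:
  assumes A: "A \<in> carrier_mat n n"
  shows "mat_poly (pCons a p) A = a \<cdot>\<^sub>m 1\<^sub>m n + A * mat_poly p A"
proof (cases "a = 0 \<and> p = 0")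
  case True
  then show ?thesis using A by (auto simp: mat_poly_def)
next
  case False
  then show ?thesis using A by (cases "p = 0") (auto simp: mat_poly_def)
qed

lemma mat_poly_carrier [simp]:
  assumes A: "A \<in> carrier_mat n n"
  shows "mat_poly p A \<in> carrier_mat n n"
  using A by (induction p) (auto simp: mat_poly_0 mat_poly_pCons)

lemma mat_poly_dim [simp]:
  "dim_row (mat_poly p A) = dim_row A" "dim_col (mat_poly p A) = dim_row A"
proof -
  have "mat_poly p A \<in> carrier_mat (dim_row A) (dim_row A)"
  proof (induction p)
    case 0
    then show ?case by (simp add: mat_poly_def)
  next
    case (pCons a p)
    then show ?case by (cases "p = 0") (auto simp: mat_poly_def)
  qed
  then show "dim_row (mat_poly p A) = dim_row A" "dim_col (mat_poly p A) = dim_row A" by auto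
qed

lemma mat_poly_add:
  assumes A: "A \<in> carrier_mat n n"
  shows "mat_poly (p + q) A = mat_poly p A + mat_poly q A"
proof (induction p q rule: poly_induct2)
  case 0
  then show ?case using A by (simp add: mat_poly_0)
next
  case (pCons a p b q)
  have c [simp]: "mat_poly r A \<in> carrier_mat n n" for r using A by simp
  have "A * (mat_poly p A + mat_poly q A) = A * mat_poly p A + A * mat_poly q A"
    by (rule mult_add_distrib_mat[OF A c c])
  then have "mat_poly (pCons a p + pCons b q) A =
      (a + b) \<cdot>\<^sub>m 1\<^sub>m n + (A * mat_poly p A + A * mat_poly q A)"
    by (simp add: mat_poly_pCons[OF A] pCons)
  then show ?case
    using A by (auto simp: mat_poly_pCons[OF A] algebra_simps intro!: eq_matI)
qed

lemma mat_poly_smult: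
  assumes A: "A \<in> carrier_mat n n"
  shows "mat_poly (Polynomial.smult c p) A = c \<cdot>\<^sub>m mat_poly p A"
proof (induction p)
  case 0
  then show ?case using A by (simp add: mat_poly_0)
next
  case (pCons a p)
  have c: "mat_poly p A \<in> carrier_mat n n" using A by simp
  have "A * (c \<cdot>\<^sub>m mat_poly p A) = c \<cdot>\<^sub>m (A * mat_poly p A)"
    by (rule mult_smult_distrib[OF A c])
  then have "mat_poly (Polynomial.smult c (pCons a p)) A =
      (c * a) \<cdot>\<^sub>m 1\<^sub>m n + c \<cdot>\<^sub>m (A * mat_poly p A)"
    by (simp add: mat_poly_pCons[OF A] pCons del: index_mult_mat)
  then show ?case
    using A by (auto simp: mat_poly_pCons[OF A] algebra_simps intro!: eq_matI)
qed

lemma mat_poly_minus: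
  assumes A: "A \<in> carrier_mat n n"
  shows "mat_poly (p - q) A = mat_poly p A - mat_poly q A"
proof -
  have c: "mat_poly r A \<in> carrier_mat n n" for r using A by simp
  have "mat_poly (p + Polynomial.smult (-1) q) A = mat_poly p A + (-1) \<cdot>\<^sub>m mat_poly q A"
    by (simp only: mat_poly_add[OF A] mat_poly_smult[OF A])
  then show ?thesis using c[of p] c[of q] by (auto intro!: eq_matI)
qed

lemma mat_poly_mult:
  assumes A: "A \<in> carrier_mat n n"
  shows "mat_poly (p * q) A = mat_poly p A * mat_poly q A"
proof (induction p)
  case 0
  have "mat_poly q A \<in> carrier_mat n n" using A by simp
  then show ?case using A left_mult_zero_mat[of "mat_poly q A" n n n] by (simp add: mat_poly_0)
next
  case (pCons a p)
  have c: "mat_poly r A \<in> carrier_mat n n" for r using A by simp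
  have "mat_poly (pCons a p * q) A = a \<cdot>\<^sub>m mat_poly q A + (0 \<cdot>\<^sub>m 1\<^sub>m n + A * (mat_poly p A * mat_poly q A))"
    by (simp only: mult_pCons_left mat_poly_add[OF A] mat_poly_smult[OF A] mat_poly_pCons[OF A] pCons)
  also have "\<dots> = a \<cdot>\<^sub>m 1\<^sub>m n * mat_poly q A + A * mat_poly p A * mat_poly q A"
    using mult_smult_assoc_mat[OF one_carrier_mat c[of q], of a] c[of p] c[of q] A
    by (auto simp: assoc_mult_mat[OF A c c] intro!: eq_matI)
  also have "\<dots> = (a \<cdot>\<^sub>m 1\<^sub>m n + A * mat_poly p A) * mat_poly q A"
    by (rule add_mult_distrib_mat[symmetric]) (use A c in auto)
  finally show ?case by (simp only: mat_poly_pCons[OF A])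
qed

lemma mat_poly_const:
  assumes A: "A \<in> carrier_mat n n"
  shows "mat_poly [:c:] A = c \<cdot>\<^sub>m 1\<^sub>m n"
  using A by (auto simp: mat_poly_pCons[OF A] mat_poly_0 intro!: eq_matI)

lemma mat_poly_1:
  assumes A: "A \<in> carrier_mat n n"
  shows "mat_poly 1 A = 1\<^sub>m n"
  using mat_poly_const[OF A, of 1] by (auto simp: one_pCons intro!: eq_matI)

lemma mat_poly_linear:
  assumes A: "A \<in> carrier_mat n n"
  shows "mat_poly [:c, d:] A = c \<cdot>\<^sub>m 1\<^sub>m n + d \<cdot>\<^sub>m A"
proof -
  have "mat_poly [:c, d:] A = c \<cdot>\<^sub>m 1\<^sub>m n + A * (d \<cdot>\<^sub>m 1\<^sub>m n)"
    by (simp only: mat_poly_pCons[OF A, of c] mat_poly_const[OF A])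
  also have "A * (d \<cdot>\<^sub>m 1\<^sub>m n) = d \<cdot>\<^sub>m A"
    using mult_smult_distrib[OF A one_carrier_mat] A by simp
  finally show ?thesis .
qed

lemma mat_poly_X_scaled:
  assumes A: "A \<in> carrier_mat n n"
  shows "mat_poly [:0, d:] A = d \<cdot>\<^sub>m A"
  using A by (auto simp: mat_poly_linear[OF A] intro!: eq_matI)

lemma mat_poly_power:
  assumes A: "A \<in> carrier_mat n n"
  shows "mat_poly (p ^ k) A = mat_poly p A ^\<^sub>m k"
proof (induction k)
  case 0
  show ?case using A by (auto simp: mat_poly_1)
next
  case (Suc k)
  have "mat_poly (p ^ k * p) A = mat_poly (p ^ k) A * mat_poly p A" by (rule mat_poly_mult[OF A])
  then show ?case using Suc by (simp add: power_commutes)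
qed

lemma mat_poly_X_power:
  assumes A: "A \<in> carrier_mat n n"
  shows "mat_poly ([:0, 1:] ^ k) A = A ^\<^sub>m k"
proof -
  have "1 \<cdot>\<^sub>m A = A" by auto
  then show ?thesis by (simp add: mat_poly_power[OF A] mat_poly_X_scaled[OF A])
qed

lemma mat_poly_pcompose:
  assumes A: "A \<in> carrier_mat n n"
  shows "mat_poly (pcompose p r) A = mat_poly p (mat_poly r A)"
proof (induction p)
  case 0
  have "mat_poly r A \<in> carrier_mat n n" using A by simp
  then show ?case using A by (simp add: mat_poly_0)
next
  case (pCons a p)
  have c: "mat_poly r A \<in> carrier_mat n n" using A by simp
  show ?case
    by (simp only: pcompose_pCons mat_poly_add[OF A] mat_poly_mult[OF A] mat_poly_const[OF A]
        mat_poly_pCons[OF c] pCons)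
qed

lemma mat_poly_prod_list:
  assumes A: "A \<in> carrier_mat n n"
  shows "mat_poly (prod_list ps) A = mat_prod n (map (\<lambda>p. mat_poly p A) ps)"
  by (induction ps) (auto simp: mat_prod_def mat_poly_1[OF A] mat_poly_mult[OF A])

section \<open>Annihilating polynomials from the Jordan form\<close>

lemma mat_poly_similar:
  assumes sim: "similar_mat_wit A B P Q" and A: "A \<in> carrier_mat n n"
  shows "mat_poly p A = P * mat_poly p B * Q"
proof -
  note w = similar_mat_witD2[OF A sim]
  have c [simp]: "mat_poly r B \<in> carrier_mat n n" for r using w by simp
  show ?thesis
  proof (induction p)
    case 0
    show ?case using w A by (simp add: mat_poly_0)
  next
    case (pCons a p)
    let ?M = "mat_poly p B"
    note closed [simp] = w(5-7) mult_carrier_mat[of _ n n _ n]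
    note assoc = assoc_mult_mat[of _ n n _ n _ n]
    have "A * mat_poly p A = P * B * Q * (P * ?M * Q)" using pCons w(3) by simp
    also have "\<dots> = P * B * (Q * (P * (?M * Q)))" by (simp add: assoc)
    also have "Q * (P * (?M * Q)) = ?M * Q"
      using w(2) left_mult_one_mat[of "?M * Q" n n] by (simp add: assoc[of Q P, symmetric])
    also have "P * B * (?M * Q) = P * (B * ?M) * Q" by (simp add: assoc)
    finally have 1: "A * mat_poly p A = P * (B * ?M) * Q" .
    have "P * (a \<cdot>\<^sub>m 1\<^sub>m n) = a \<cdot>\<^sub>m P"
      using mult_smult_distrib[OF w(6) one_carrier_mat, of a] w(6) by simp
    then have 2: "a \<cdot>\<^sub>m 1\<^sub>m n = P * (a \<cdot>\<^sub>m 1\<^sub>m n) * Q"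
      using mult_smult_assoc_mat[OF w(6,7), of a] w(1) by simp
    have "P * (a \<cdot>\<^sub>m 1\<^sub>m n + B * ?M) * Q = (P * (a \<cdot>\<^sub>m 1\<^sub>m n) + P * (B * ?M)) * Q"
      by (subst mult_add_distrib_mat[OF w(6)]) (use w(5,6) c[of p] in auto)
    also have "\<dots> = P * (a \<cdot>\<^sub>m 1\<^sub>m n) * Q + P * (B * ?M) * Q"
      by (rule add_mult_distrib_mat[of _ n n _ _ n]) (use w(5-7) c[of p] in auto)
    finally show ?case
      unfolding mat_poly_pCons[OF A] mat_poly_pCons[OF w(5)] using 1 2 by simp
  qed
qed

lemma mat_poly_four_block_diag:
  assumes A: "A \<in> carrier_mat n n" and B: "B \<in> carrier_mat m m"
  shows "mat_poly p (four_block_mat A (0\<^sub>m n m) (0\<^sub>m m n) B) =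
         four_block_mat (mat_poly p A) (0\<^sub>m n m) (0\<^sub>m m n) (mat_poly p B)" (is "mat_poly p ?F = _")
proof (induction p)
  case 0
  show ?case using A B by (simp add: mat_poly_0)
next
  case (pCons a p)
  have F: "?F \<in> carrier_mat (n + m) (n + m)" using A B by simp
  have cA: "mat_poly p A \<in> carrier_mat n n" and cB: "mat_poly p B \<in> carrier_mat m m"
    using A B by simp_all
  have prod: "?F * mat_poly p ?F =
      four_block_mat (A * mat_poly p A) (0\<^sub>m n m) (0\<^sub>m m n) (B * mat_poly p B)"
    unfolding pCons
    by (subst mult_four_block_mat[OF A _ _ B cA _ _ cB]) (use A B cA cB in auto)
  have one: "a \<cdot>\<^sub>m 1\<^sub>m (n + m) =
      four_block_mat (a \<cdot>\<^sub>m 1\<^sub>m n) (0\<^sub>m n m) (0\<^sub>m m n) (a \<cdot>\<^sub>m 1\<^sub>m m)"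
    by (auto intro!: eq_matI)
  show ?case
    unfolding mat_poly_pCons[OF F] mat_poly_pCons[OF A] mat_poly_pCons[OF B] prod one
    by (subst add_four_block_mat[of _ n n _ m _ m]) (use A B cA cB in auto)
qed

text \<open>Evaluating \<open>X - a\<close> at the block leaves the nilpotent block, whose \<open>m\<close>-th power vanishes.\<close>

lemma mat_poly_jordan_block_zero:
  fixes a :: "'a::field"
  assumes "[:-a, 1:] ^ m dvd p"
  shows "mat_poly p (jordan_block m a) = 0\<^sub>m m m"
proof -
  let ?J = "jordan_block m a"
  have J: "?J \<in> carrier_mat m m" by simp
  obtain r where p: "p = [:-a, 1:] ^ m * r" using assms by (elim dvdE)
  have "mat_poly [:-a, 1:] ?J = jordan_block m 0"
    by (simp add: mat_poly_linear[OF J]) (auto simp: jordan_block_def intro!: eq_matI)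
  then have "mat_poly ([:-a, 1:] ^ m) ?J = jordan_block m 0 ^\<^sub>m m"
    by (simp add: mat_poly_power[OF J])
  also have "\<dots> = 0\<^sub>m m m" by (auto simp: jordan_block_zero_pow intro!: eq_matI)
  finally show ?thesis
    using mat_poly_carrier[OF J, of r] by (simp add: p mat_poly_mult[OF J])
qed

lemma mat_poly_jordan_matrix_zero:
  fixes p :: "'a::field poly"
  assumes "\<And>m a. (m, a) \<in> set n_as \<Longrightarrow> [:-a, 1:] ^ m dvd p"
  shows "mat_poly p (jordan_matrix n_as) = 0\<^sub>m (sum_list (map fst n_as)) (sum_list (map fst n_as))"
  using assms
proof (induction n_as)
  case Nil
  then show ?case
    using mat_poly_carrier[OF jordan_matrix_carrier[of "[]"], of p] by (auto intro!: eq_matI)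
next
  case (Cons na n_as)
  obtain m a where na: "na = (m, a)" by force
  show ?case
    unfolding na jordan_matrix_Cons
    by (subst mat_poly_four_block_diag)
       (use Cons na in \<open>auto simp: mat_poly_jordan_block_zero intro!: eq_matI\<close>)
qed

lemma mat_poly_jordan_nf_zero:
  fixes p :: "'a::field poly"
  assumes A: "A \<in> carrier_mat n n" and jnf: "jordan_nf A n_as"
    and "\<And>m a. (m, a) \<in> set n_as \<Longrightarrow> [:-a, 1:] ^ m dvd p"
  shows "mat_poly p A = 0\<^sub>m n n"
proof -
  obtain P Q where w: "similar_mat_wit A (jordan_matrix n_as) P Q"
    using jnf by (auto simp: jordan_nf_def similar_mat_def)
  note W = similar_mat_witD2[OF A w]
  have "sum_list (map fst n_as) = n" using W(5) jordan_matrix_dim(1)[of n_as] by auto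
  then show ?thesis
    using mat_poly_similar[OF w A, of p] mat_poly_jordan_matrix_zero[OF assms(3)] W by simp
qed

text \<open>Block sizes for \<open>a\<close> are bounded by the multiplicity of \<open>a\<close> as a root of the characteristic
polynomial. So the set whose maximum defines the index of \<open>a\<close> is finite, and the index does bound every
block.\<close>

lemma eigenvalue_index_block:
  assumes A: "A \<in> carrier_mat n n" and jnf: "jordan_nf A n_as" and mem: "(m, a) \<in> set n_as"
  shows "eigenvalue A a" and "m \<le> eigenvalue_index A a"
proof -
  have "m \<noteq> 0" using jnf mem by (force simp: jordan_nf_def)
  moreover have "m \<le> Polynomial.order a (char_poly A)" by (rule jordan_nf_block_size_order_bound[OF jnf mem])
  ultimately have "poly (char_poly A) a = 0" by (auto simp: order_root)
  then show "eigenvalue A a" by (simp add: eigenvalue_root_char_poly[OF A])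
  let ?S = "{m. \<exists>n_as. jordan_nf A n_as \<and> (m, a) \<in> set n_as}"
  have "?S \<subseteq> {..Polynomial.order a (char_poly A)}" by (auto dest: jordan_nf_block_size_order_bound)
  then have "finite ?S" by (rule finite_subset) simp
  then show "m \<le> eigenvalue_index A a"
    unfolding eigenvalue_index_def using jnf mem by (intro Max_ge) auto
qed

text \<open>The exponents \<open>us i\<close> dominate the sizes of all Jordan blocks, so the product is a multiple of the
minimal polynomial.\<close>

lemma mat_poly_annihilator:
  assumes A: "A \<in> carrier_mat n n" and I: "finite I" "lam ` I = {l. eigenvalue A l}"
    and us: "\<And>i. i \<in> I \<Longrightarrow> eigenvalue_index A (lam i) \<le> us i"
  shows "mat_poly (\<Prod>i\<in>I. [:-lam i, 1:] ^ us i) A = 0\<^sub>m n n"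
proof -
  obtain as where "char_poly A = (\<Prod>a\<leftarrow>as. [:-a, 1:])" using char_poly_factorized[OF A] by blast
  then obtain n_as where jnf: "jordan_nf A n_as" using jordan_nf_exists[OF A] by blast
  have "[:-a, 1:] ^ m dvd (\<Prod>i\<in>I. [:-lam i, 1:] ^ us i)" if "(m, a) \<in> set n_as" for m a
  proof -
    note ev = eigenvalue_index_block[OF A jnf that]
    then obtain i where i: "i \<in> I" "a = lam i" using I(2) by blast
    have "[:-a, 1:] ^ m dvd [:-lam i, 1:] ^ us i"
      using ev(2) us[OF i(1)] i(2) by (simp add: le_imp_power_dvd)
    also have "\<dots> dvd (\<Prod>i\<in>I. [:-lam i, 1:] ^ us i)" using I(1) i(1) by (rule dvd_prodI)
    finally show ?thesis .
  qed
  then show ?thesis by (rule mat_poly_jordan_nf_zero[OF A jnf])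
qed

section \<open>Rank, range and index\<close>

text \<open>A basis of the smaller range is linearly independent in the larger one and has as many elements as
its dimension, so it spans the larger range too.\<close>

lemma mat_range_eqI_rank:
  assumes A: "A \<in> carrier_mat n n" and B: "B \<in> carrier_mat n n"
    and sub: "mat_range A \<subseteq> mat_range B" and rank: "vec_space.rank n A = vec_space.rank n B"
  shows "mat_range A = mat_range B"
proof -
  interpret vec_space "TYPE(complex)" n .
  have range: "span (set (cols M)) = mat_range M" if "M \<in> carrier_mat n n" for M
    using col_space_eq[OF that] that by (auto simp: col_space_def mat_range_def)
  have sp: "subspace class_ring (mat_range M) V" if "M \<in> carrier_mat n n" for M
    using range[OF that] span_is_subspace[of "set (cols M)"] cols_dim[of M] that by auto
  have fin: "vectorspace.fin_dim class_ring (vs (mat_range M))" if "M \<in> carrier_mat n n" for M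
    using fin_dim_span_cols[OF that] range[OF that] by simp
  note vA = subspace_is_vs[OF sp[OF A]] and vB = subspace_is_vs[OF sp[OF B]]
  have smA: "submodule class_ring (mat_range A) V" and smB: "submodule class_ring (mat_range B) V"
    using sp A B by (auto simp: subspace_def)
  obtain b where b: "finite b" "vectorspace.basis class_ring (vs (mat_range A)) b"
    using vectorspace.finite_basis_exists[OF vA fin[OF A]] by blast
  have card: "vectorspace.dim class_ring (vs (mat_range A)) = card b"
    by (rule vectorspace.dim_basis[OF vA b])
  have bA: "b \<subseteq> mat_range A"
    and li: "\<not> LinearCombinations.module.lin_dep class_ring (vs (mat_range A)) b"
    and gen: "LinearCombinations.module.span class_ring (vs (mat_range A)) b = mat_range A"
    using b(2) by (auto simp: vectorspace.basis_def[OF vA])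
  have bB: "b \<subseteq> mat_range B" using bA sub by blast
  have "lin_indpt b" using li span_li_not_depend(2)[OF bA smA] by simp
  then have liB: "\<not> LinearCombinations.module.lin_dep class_ring (vs (mat_range B)) b"
    using span_li_not_depend(2)[OF bB smB] by simp
  have "vectorspace.dim class_ring (vs (mat_range B)) \<le> card b"
    using rank card range[OF A] range[OF B] by (simp add: rank_def)
  then have "vectorspace.basis class_ring (vs (mat_range B)) b"
    using vectorspace.dim_li_is_basis[OF vB fin[OF B] b(1) _ liB] bB by simp
  then have "LinearCombinations.module.span class_ring (vs (mat_range B)) b = mat_range B"
    by (auto simp: vectorspace.basis_def[OF vB])
  then show ?thesis
    using gen span_li_not_depend(1)[OF bA smA] span_li_not_depend(1)[OF bB smB] by simp
qed

lemma rank_cong_mat_range: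
  assumes A: "A \<in> carrier_mat n n" and B: "B \<in> carrier_mat n n"
    and "mat_range A = mat_range B"
  shows "vec_space.rank n A = vec_space.rank n B"
proof -
  interpret vec_space "TYPE(complex)" n .
  have "span (set (cols M)) = mat_range M" if "M \<in> carrier_mat n n" for M
    using col_space_eq[OF that] that by (auto simp: col_space_def mat_range_def)
  then show ?thesis using assms by (simp add: rank_def)
qed

lemma mat_range_square:
  "M \<in> carrier_mat n n \<Longrightarrow> mat_range M = (\<lambda>v. M *\<^sub>v v) ` carrier_vec n"
  by (auto simp: mat_range_def)

lemma mat_range_mult_subset:
  assumes "M \<in> carrier_mat n n" "N \<in> carrier_mat n n"
  shows "mat_range (M * N) \<subseteq> mat_range M"
  using assms by (auto simp: mat_range_def)

lemma zero_matI_mult_vec: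
  fixes M :: "'a::comm_ring_1 mat"
  assumes M: "M \<in> carrier_mat n n" and 0: "\<And>v. v \<in> carrier_vec n \<Longrightarrow> M *\<^sub>v v = 0\<^sub>v n"
  shows "M = 0\<^sub>m n n"
proof (rule eq_matI)
  fix i j assume "i < dim_row (0\<^sub>m n n :: 'a mat)" and "j < dim_col (0\<^sub>m n n :: 'a mat)"
  then have ij: "i < n" "j < n" by auto
  have "(M *\<^sub>v unit_vec n j) $ i = 0" using 0[of "unit_vec n j"] ij by simp
  then show "M $$ (i, j) = (0\<^sub>m n n :: 'a mat) $$ (i, j)" using M ij by simp
qed (use M in auto)

lemma pow_mat_add:
  fixes S :: "'a::comm_ring_1 mat"
  assumes S: "S \<in> carrier_mat n n"
  shows "S ^\<^sub>m (i + j) = S ^\<^sub>m i * S ^\<^sub>m j"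
  using mat_poly_mult[OF S, of "[:0,1:] ^ i" "[:0,1:] ^ j"]
  by (simp only: mat_poly_X_power[OF S] power_add[symmetric])

text \<open>An idempotent is determined by its range and kernel: if \<open>Y\<close> and \<open>Z\<close> share both, then \<open>Z\<close> fixes
\<open>Y v\<close> and kills \<open>v - Y v\<close>, so \<open>Z v = Y v\<close>. Hence the definite description denotes \<open>Z\<close>.\<close>

lemma eigenprojection_eqI:
  assumes S: "S \<in> carrier_mat n n" and Z: "Z \<in> carrier_mat n n" and idem: "Z * Z = Z"
    and range: "mat_range Z = mat_kernel (S ^\<^sub>m mat_index S)"
    and kernel: "mat_kernel Z = mat_range (S ^\<^sub>m mat_index S)"
  shows "eigenprojection S = Z"
  unfolding eigenprojection_def
proof (rule the_equality, goal_cases)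
  case 1
  then show ?case using assms by simp
next
  case (2 Y)
  then have Y: "Y \<in> carrier_mat n n" and YY: "Y * Y = Y"
    and rY: "mat_range Y = mat_range Z" and kY: "mat_kernel Y = mat_kernel Z"
    using assms by auto
  have "(Y - Z) *\<^sub>v v = 0\<^sub>v n" if v: "v \<in> carrier_vec n" for v
  proof -
    have Yv: "Y *\<^sub>v v \<in> carrier_vec n" and Zv: "Z *\<^sub>v v \<in> carrier_vec n" using Y Z v by auto
    have "Y *\<^sub>v v \<in> mat_range Z" using rY v Y by (auto simp: mat_range_def)
    then obtain w where w: "w \<in> carrier_vec n" "Y *\<^sub>v v = Z *\<^sub>v w" using Z by (auto simp: mat_range_def)
    have Z_Y: "Z *\<^sub>v (Y *\<^sub>v v) = Y *\<^sub>v v"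
      using assoc_mult_mat_vec[OF Z Z w(1)] w(2) idem by simp
    have "Y *\<^sub>v (v - Y *\<^sub>v v) = 0\<^sub>v n"
      using mult_minus_distrib_mat_vec[OF Y v Yv] assoc_mult_mat_vec[OF Y Y v] YY Yv by simp
    then have "v - Y *\<^sub>v v \<in> mat_kernel Z"
      using kY Y v Yv mat_kernelI[OF Y, of "v - Y *\<^sub>v v"] by auto
    then have "Z *\<^sub>v (v - Y *\<^sub>v v) = 0\<^sub>v n" using mat_kernelD[OF Z] by blast
    then have "Z *\<^sub>v v - Y *\<^sub>v v = 0\<^sub>v n"
      using mult_minus_distrib_mat_vec[OF Z v Yv] Z_Y by simp
    then have "Z *\<^sub>v v = Y *\<^sub>v v" using Yv Zv Y Z by (auto simp: vec_eq_iff)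
    then show ?thesis using minus_mult_distrib_mat_vec[OF Y Z v] Yv by simp
  qed
  then have "Y - Z = 0\<^sub>m n n" using Y Z by (intro zero_matI_mult_vec) auto
  then show ?case using Y Z by (auto simp: mat_eq_iff)
qed

text \<open>With \<open>q = c + X r\<close> and \<open>c \<noteq> 0\<close>, the annihilator says \<open>c S^N = - S^(N+1) r(S)\<close>. So \<open>S^N\<close> factors through
\<open>S^(N+1)\<close>, and the two powers have the same range.\<close>

lemma rank_pow_stable:
  fixes S :: "complex mat"
  assumes S: "S \<in> carrier_mat n n"
    and ann: "mat_poly ([:0, 1:] ^ N * q) S = 0\<^sub>m n n" and q: "poly q 0 \<noteq> 0"
  shows "vec_space.rank n (S ^\<^sub>m (N + 1)) = vec_space.rank n (S ^\<^sub>m N)"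
proof (rule rank_cong_mat_range)
  obtain c r where q_eq: "q = pCons c r" by (cases q)
  with q have c: "c \<noteq> 0" by simp
  let ?X = "[:0, 1:] :: complex poly"
  have *: "?X ^ N * q = Polynomial.smult c (?X ^ N) + ?X ^ (N + 1) * r"
    by (simp add: q_eq)
  define r' where "r' = Polynomial.smult (- 1 / c) r"
  define R where "R = mat_poly r' S"
  have R: "R \<in> carrier_mat n n" using S by (simp add: R_def)
  have "?X ^ N = ?X ^ (N + 1) * r' + Polynomial.smult (1 / c) (?X ^ N * q)"
    using c by (simp add: * smult_add_right r'_def)
  then have "mat_poly (?X ^ N) S = mat_poly (?X ^ (N + 1) * r') S + (1 / c) \<cdot>\<^sub>m 0\<^sub>m n n"
    using mat_poly_add[OF S] mat_poly_smult[OF S] ann by metis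
  then have "S ^\<^sub>m N = S ^\<^sub>m (N + 1) * R + 0\<^sub>m n n"
    by (simp only: mat_poly_mult[OF S] mat_poly_X_power[OF S] smult_zero_mat R_def)
  then have eq: "S ^\<^sub>m N = S ^\<^sub>m (N + 1) * R"
    using right_add_zero_mat[OF mult_carrier_mat[OF pow_carrier_mat[OF S] R]] by metis
  show "S ^\<^sub>m (N + 1) \<in> carrier_mat n n" "S ^\<^sub>m N \<in> carrier_mat n n"
    using S pow_carrier_mat by blast+
  show "mat_range (S ^\<^sub>m (N + 1)) = mat_range (S ^\<^sub>m N)"
  proof
    show "mat_range (S ^\<^sub>m (N + 1)) \<subseteq> mat_range (S ^\<^sub>m N)"
      using mat_range_mult_subset[of "S ^\<^sub>m N" n S] S by simp
    show "mat_range (S ^\<^sub>m N) \<subseteq> mat_range (S ^\<^sub>m (N + 1))"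
      by (subst eq) (rule mat_range_mult_subset[OF pow_carrier_mat[OF S] R])
  qed
qed

lemma mat_index_le:
  assumes S: "S \<in> carrier_mat n n"
    and ann: "mat_poly ([:0, 1:] ^ N * q) S = 0\<^sub>m n n" and q: "poly q 0 \<noteq> 0"
  shows "mat_index S \<le> N"
  unfolding mat_index_def
  by (rule Least_le) (use rank_pow_stable[OF assms] S in simp)

text \<open>At the index the ranks of two consecutive powers agree, hence so do their ranges, as one contains
the other. Applying further powers of \<open>S\<close> to both sides propagates the equality. The annihilator
guarantees that such an exponent exists at all, so that the least one satisfies its defining property.\<close>

lemma mat_range_index_stable:
  assumes S: "S \<in> carrier_mat n n"
    and ann: "mat_poly ([:0, 1:] ^ N * q) S = 0\<^sub>m n n" and q: "poly q 0 \<noteq> 0"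
  shows "mat_range (S ^\<^sub>m (mat_index S + k)) = mat_range (S ^\<^sub>m mat_index S)"
proof (induction k)
  case (Suc k)
  let ?v = "mat_index S"
  have c: "S ^\<^sub>m j \<in> carrier_mat n n" for j using S by simp
  have "vec_space.rank (dim_row S) (S ^\<^sub>m (?v + 1)) = vec_space.rank (dim_row S) (S ^\<^sub>m ?v)"
    unfolding mat_index_def by (rule LeastI) (use rank_pow_stable[OF assms] S in simp)
  then have "vec_space.rank n (S ^\<^sub>m (?v + 1)) = vec_space.rank n (S ^\<^sub>m ?v)" using S by simp
  then have step: "mat_range (S ^\<^sub>m (?v + 1)) = mat_range (S ^\<^sub>m ?v)"
    by (intro mat_range_eqI_rank[OF c c])
       (use mat_range_mult_subset[OF c S, of ?v] in simp)
  have img: "mat_range (S ^\<^sub>m (k + j)) = (\<lambda>v. S ^\<^sub>m k *\<^sub>v v) ` mat_range (S ^\<^sub>m j)" for j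
    unfolding mat_range_square[OF c, of j] pow_mat_add[OF S] image_image
    by (subst mat_range_square[OF mult_carrier_mat[OF c c]])
       (use assoc_mult_mat_vec[OF c c] in \<open>auto intro!: image_cong\<close>)
  show ?case
    using img[of "?v + 1"] img[of ?v] step Suc by (simp add: add.commute add.left_commute)
qed simp

text \<open>Every vector \<open>S^\<nu> v\<close>, where \<open>\<nu>\<close> is the index, equals \<open>S^(\<nu> + N) w\<close> for some \<open>w\<close>, and there
\<open>q(S)\<close> vanishes.\<close>

lemma mat_poly_index_annihilates:
  assumes S: "S \<in> carrier_mat n n"
    and ann: "mat_poly ([:0, 1:] ^ N * q) S = 0\<^sub>m n n" and q: "poly q 0 \<noteq> 0"
  shows "mat_poly ([:0, 1:] ^ mat_index S * q) S = 0\<^sub>m n n"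
proof (rule zero_matI_mult_vec)
  show "mat_poly ([:0, 1:] ^ mat_index S * q) S \<in> carrier_mat n n" using S by simp
  fix v :: "complex vec" assume v: "v \<in> carrier_vec n"
  let ?v = "mat_index S"
  have c: "S ^\<^sub>m j \<in> carrier_mat n n" for j using S by simp
  have Q: "mat_poly q S \<in> carrier_mat n n" using S by simp
  have split: "mat_poly ([:0, 1:] ^ j * q) S = mat_poly q S * S ^\<^sub>m j" for j
    by (simp only: mat_poly_mult[OF S] mat_poly_X_power[OF S] mult.commute[of _ q])
  have "S ^\<^sub>m ?v *\<^sub>v v \<in> mat_range (S ^\<^sub>m (?v + N))"
    unfolding mat_range_index_stable[OF assms] using v c by (auto simp: mat_range_square[OF c])
  then obtain w where w: "w \<in> carrier_vec n" "S ^\<^sub>m ?v *\<^sub>v v = S ^\<^sub>m (N + ?v) *\<^sub>v w"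
    by (auto simp: mat_range_square[OF c] add.commute)
  define x where "x = S ^\<^sub>m ?v *\<^sub>v w"
  have x: "x \<in> carrier_vec n" unfolding x_def by (rule mult_mat_vec_carrier[OF c w(1)])
  have "mat_poly ([:0, 1:] ^ ?v * q) S *\<^sub>v v = mat_poly q S *\<^sub>v (S ^\<^sub>m N *\<^sub>v x)"
    using split assoc_mult_mat_vec[OF Q c v] w assoc_mult_mat_vec[OF c c w(1)]
    by (simp add: pow_mat_add[OF S] x_def)
  also have "\<dots> = 0\<^sub>m n n *\<^sub>v x"
    by (metis ann split assoc_mult_mat_vec[OF Q c x])
  also have "\<dots> = 0\<^sub>v n" using x by (intro eq_vecI) auto
  finally show "mat_poly ([:0, 1:] ^ ?v * q) S *\<^sub>v v = 0\<^sub>v n" .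
qed

section \<open>The eigenprojection as a polynomial in the matrix\<close>

text \<open>As \<open>X^N\<close> and \<open>q\<close> are coprime, the space is the direct sum of the kernel of a high power of \<open>S\<close>, on which
\<open>e(S)\<close> is the identity since \<open>e = 1\<close> modulo \<open>X^u\<close>, and the kernel of \<open>q(S)\<close>, on which \<open>e(S)\<close> is zero since \<open>q\<close>
divides \<open>e\<close>. Only the index \<open>\<nu>\<close> enters the definition of the eigenprojection, so \<open>u\<close> and \<open>N\<close> are
first replaced by \<open>\<nu>\<close>.\<close>

lemma eigenprojection_eq_mat_poly:
  assumes S: "S \<in> carrier_mat n n"
    and ann: "mat_poly ([:0, 1:] ^ N * q) S = 0\<^sub>m n n" and q: "poly q 0 \<noteq> 0"
    and u: "mat_index S \<le> u" and qe: "q dvd e" and e: "[:0, 1:] ^ u dvd 1 - e"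
  shows "eigenprojection S = mat_poly e S"
proof -
  let ?v = "mat_index S" and ?X = "[:0, 1:] :: complex poly"
  let ?Z = "mat_poly e S"
  have c [simp]: "mat_poly p S \<in> carrier_mat n n" for p using S by simp
  have X: "S ^\<^sub>m k = mat_poly (?X ^ k) S" for k by (simp add: mat_poly_X_power[OF S])
  obtain t where t: "e = q * t" using qe by (elim dvdE)
  have "mat_poly (?X ^ ?v * e) S = 0\<^sub>m n n"
    using mat_poly_index_annihilates[OF S ann q] left_mult_zero_mat[OF c[of t], of n]
    by (simp only: t mult.assoc[symmetric] mat_poly_mult[OF S, of _ t])
  then have kill: "mat_poly (p * (?X ^ ?v * e)) S = 0\<^sub>m n n" for p
    using right_mult_zero_mat[OF c[of p], of n] by (simp only: mat_poly_mult[OF S, of p])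
  have "?X ^ ?v dvd 1 - e" using e u by (meson dvd_trans le_imp_power_dvd)
  then obtain r where r: "1 - e = ?X ^ ?v * r" by (elim dvdE)
  \<comment> \<open>The splitting of \<open>v\<close> along \<open>1 = e + (1 - e)\<close>.\<close>
  have decomp: "v = ?Z *\<^sub>v v + mat_poly (?X ^ ?v * r) S *\<^sub>v v" if "v \<in> carrier_vec n" for v
  proof -
    have "mat_poly (e + ?X ^ ?v * r) S = 1\<^sub>m n" using mat_poly_1[OF S] by (simp flip: r)
    then have "(?Z + mat_poly (?X ^ ?v * r) S) *\<^sub>v v = v"
      using that by (simp add: mat_poly_add[OF S])
    then show ?thesis using add_mult_distrib_mat_vec[OF c c that] by simp
  qed
  have comp: "mat_poly p S *\<^sub>v (mat_poly p' S *\<^sub>v v) = mat_poly (p * p') S *\<^sub>v v"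
    if "v \<in> carrier_vec n" for p p' v
    using that assoc_mult_mat_vec[OF c c that, of p p'] by (simp add: mat_poly_mult[OF S])
  have closed [simp]: "mat_poly p S *\<^sub>v v \<in> carrier_vec n" if "v \<in> carrier_vec n" for p v
    using that by (rule mult_mat_vec_carrier[OF c])
  have zero_vec: "0\<^sub>m n n *\<^sub>v v = 0\<^sub>v n" if "v \<in> carrier_vec n" for v :: "complex vec"
    using that by (intro eq_vecI) auto
  have zero: "mat_poly p S *\<^sub>v 0\<^sub>v n = 0\<^sub>v n" for p
    using S by (intro eq_vecI) (auto intro!: scalar_prod_right_zero)
  show ?thesis
  proof (rule eigenprojection_eqI[OF S c])
    \<comment> \<open>\<open>e * (1 - e)\<close> is a multiple of \<open>X^\<nu> * e\<close>, which vanishes at \<open>S\<close>.\<close>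
    have "e * (1 - e) = r * (?X ^ ?v * e)" unfolding r by (simp only: ac_simps)
    then have "e = e * e + r * (?X ^ ?v * e)" by (simp add: algebra_simps)
    then have "?Z = ?Z * ?Z + 0\<^sub>m n n" using mat_poly_add[OF S] mat_poly_mult[OF S] kill[of r] by metis
    then show "?Z * ?Z = ?Z" using right_add_zero_mat[of "?Z * ?Z" n n] c[of e] by simp
    show "mat_range ?Z = mat_kernel (S ^\<^sub>m ?v)"
    proof (intro equalityI subsetI)
      fix y assume "y \<in> mat_range ?Z"
      then obtain v where v: "v \<in> carrier_vec n" "y = ?Z *\<^sub>v v"
        by (auto simp: mat_range_square[OF c])
      have "mat_poly (?X ^ ?v) S *\<^sub>v y = 0\<^sub>v n" using kill[of 1] v zero_vec by (simp add: comp)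
      then show "y \<in> mat_kernel (S ^\<^sub>m ?v)" unfolding X using v by (intro mat_kernelI[OF c]) auto
    next
      fix y assume "y \<in> mat_kernel (S ^\<^sub>m ?v)"
      then have y: "y \<in> carrier_vec n" "mat_poly (?X ^ ?v) S *\<^sub>v y = 0\<^sub>v n"
        unfolding X using mat_kernelD[OF c] by blast+
      have "mat_poly (?X ^ ?v * r) S *\<^sub>v y = mat_poly r S *\<^sub>v (mat_poly (?X ^ ?v) S *\<^sub>v y)"
        using y(1) by (simp add: comp mult.commute)
      then have "y = ?Z *\<^sub>v y" using decomp[OF y(1)] y by (simp add: zero)
      then show "y \<in> mat_range ?Z" using y(1) by (auto simp: mat_range_square[OF c])
    qed
    show "mat_kernel ?Z = mat_range (S ^\<^sub>m ?v)"
    proof (intro equalityI subsetI)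
      fix y assume "y \<in> mat_kernel ?Z"
      then have y: "y \<in> carrier_vec n" "?Z *\<^sub>v y = 0\<^sub>v n" using mat_kernelD[OF c] by blast+
      have "mat_poly (?X ^ ?v) S *\<^sub>v (mat_poly r S *\<^sub>v y) = y"
        using decomp[OF y(1)] y by (simp add: comp)
      then show "y \<in> mat_range (S ^\<^sub>m ?v)"
        unfolding X mat_range_square[OF c] using closed[OF y(1), of r] by (metis image_eqI)
    next
      fix y assume "y \<in> mat_range (S ^\<^sub>m ?v)"
      then obtain v where v: "v \<in> carrier_vec n" "y = mat_poly (?X ^ ?v) S *\<^sub>v v"
        unfolding X by (auto simp: mat_range_square[OF c])
      have "?Z *\<^sub>v y = 0\<^sub>v n" using kill[of 1] v zero_vec by (simp add: comp mult.commute)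
      then show "y \<in> mat_kernel ?Z" using v by (intro mat_kernelI[OF c]) auto
    qed
  qed
qed


section \<open>The product over the eigenvalues\<close>

lemma dvd_one_minus_mult:
  fixes x :: "'a::comm_ring_1"
  assumes "x dvd 1 - a" "x dvd 1 - b"
  shows "x dvd 1 - a * b"
proof -
  have "1 - a * b = (1 - a) + a * (1 - b)" by (simp add: algebra_simps)
  then show ?thesis using assms by (metis dvd_add dvd_mult)
qed

lemma dvd_one_minus_power:
  fixes x :: "'a::comm_ring_1"
  shows "x dvd 1 - a \<Longrightarrow> x dvd 1 - a ^ k"
  by (induction k) (auto intro: dvd_one_minus_mult)

lemma dvd_one_minus_prod:
  fixes x :: "'a::comm_ring_1"
  shows "(\<And>i. i \<in> I \<Longrightarrow> x dvd 1 - f i) \<Longrightarrow> x dvd 1 - prod f I"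
  by (induction I rule: infinite_finite_induct) (auto intro: dvd_one_minus_mult)

lemma mat_shift_carrier:
  "A \<in> carrier_mat n n \<Longrightarrow> mat_shift A l \<in> carrier_mat n n"
  by (auto simp: mat_shift_def)

text \<open>The annihilator of \<open>A\<close>, rewritten as a polynomial in \<open>A - l I\<close> by substituting \<open>X + l\<close> for \<open>X\<close>. The
factors with \<open>lam i = l\<close> become powers of \<open>X\<close>; if \<open>l\<close> is not an eigenvalue, that power is \<open>X^0\<close>.\<close>

lemma mat_shift_annihilator:
  assumes A: "A \<in> carrier_mat n n" and I: "finite I" "lam ` I = {l. eigenvalue A l}"
    and us: "\<And>i. i \<in> I \<Longrightarrow> eigenvalue_index A (lam i) \<le> us i"
  shows "mat_poly ([:0, 1:] ^ (\<Sum>i\<in>{i\<in>I. lam i = l}. us i) *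
      (\<Prod>i\<in>{i\<in>I. lam i \<noteq> l}. [:-(lam i - l), 1:] ^ us i)) (mat_shift A l) = 0\<^sub>m n n"
proof -
  let ?S = "mat_shift A l"
  let ?f = "\<lambda>i. [:-(lam i - l), 1:] ^ us i"
  have S: "?S \<in> carrier_mat n n" using A by (rule mat_shift_carrier)
  have unshift: "mat_poly [:l, 1:] ?S = A"
    unfolding mat_poly_linear[OF S] using A by (auto simp: mat_shift_def intro!: eq_matI)
  have pcompose_power: "pcompose (p ^ m) r = pcompose p r ^ m" for p r :: "complex poly" and m
    by (induction m) (simp_all add: pcompose_1 pcompose_mult)
  have "pcompose (\<Prod>i\<in>I. [:-lam i, 1:] ^ us i) [:l, 1:] = (\<Prod>i\<in>I. ?f i)"
    by (simp add: pcompose_prod pcompose_power pcompose_pCons)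
  also have "\<dots> = (\<Prod>i\<in>{i\<in>I. lam i = l}. ?f i) * (\<Prod>i\<in>{i\<in>I. lam i \<noteq> l}. ?f i)"
    using I(1) by (subst prod.union_disjoint[symmetric]) (auto intro!: prod.cong)
  also have "(\<Prod>i\<in>{i\<in>I. lam i = l}. ?f i) = [:0, 1:] ^ (\<Sum>i\<in>{i\<in>I. lam i = l}. us i)"
    by (simp add: power_sum)
  finally show ?thesis
    using mat_poly_annihilator[OF assms] mat_poly_pcompose[OF S, of _ "[:l, 1:]"] unshift by metis
qed

lemma poly_shifted_eigenvalues_nonzero:
  fixes lam :: "'i \<Rightarrow> 'a::field"
  assumes "finite I"
  shows "poly (\<Prod>i\<in>{i\<in>I. lam i \<noteq> l}. [:-(lam i - l), 1:] ^ us i) 0 \<noteq> 0"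
  using assms by (simp add: poly_prod)

text \<open>Allowing every \<open>l\<close> serves both formulas at once: \<open>l = 0\<close> gives the eigenprojection of \<open>A\<close>, and an
eigenvalue \<open>l\<close> gives the one corresponding to \<open>l\<close>.\<close>

lemma eigenprojection_mat_shift:
  assumes A: "A \<in> carrier_mat n n" and I: "finite I" "lam ` I = {l. eigenvalue A l}"
    and us: "\<And>i. i \<in> I \<Longrightarrow> eigenvalue_index A (lam i) \<le> us i"
    and u: "mat_index (mat_shift A l) \<le> u"
  shows "eigenprojection (mat_shift A l) =
    mat_poly (\<Prod>i\<in>{i\<in>I. lam i \<noteq> l}. (1 - [:0, 1 / (lam i - l):] ^ u) ^ us i) (mat_shift A l)"
proof (rule eigenprojection_eq_mat_poly[OF _ _ _ u])
  show "mat_shift A l \<in> carrier_mat n n" using A by (rule mat_shift_carrier)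
  show "mat_poly ([:0, 1:] ^ (\<Sum>i\<in>{i\<in>I. lam i = l}. us i) *
      (\<Prod>i\<in>{i\<in>I. lam i \<noteq> l}. [:-(lam i - l), 1:] ^ us i)) (mat_shift A l) = 0\<^sub>m n n"
    using A I us by (rule mat_shift_annihilator)
  show "poly (\<Prod>i\<in>{i\<in>I. lam i \<noteq> l}. [:-(lam i - l), 1:] ^ us i) 0 \<noteq> 0"
    using I(1) by (rule poly_shifted_eigenvalues_nonzero)
  show "(\<Prod>i\<in>{i\<in>I. lam i \<noteq> l}. [:-(lam i - l), 1:] ^ us i)
      dvd (\<Prod>i\<in>{i\<in>I. lam i \<noteq> l}. (1 - [:0, 1 / (lam i - l):] ^ u) ^ us i)"
  proof (intro prod_dvd_prod dvd_power_same)
    fix i assume "i \<in> {i\<in>I. lam i \<noteq> l}"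
    \<comment> \<open>This holds for \<open>u = 0\<close> as well, where the polynomial is zero.\<close>
    then have "poly (1 - [:0, 1 / (lam i - l):] ^ u) (lam i - l) = 0" by simp
    then show "[:-(lam i - l), 1:] dvd 1 - [:0, 1 / (lam i - l):] ^ u"
      by (simp only: poly_eq_0_iff_dvd)
  qed
  show "[:0, 1:] ^ u dvd 1 - (\<Prod>i\<in>{i\<in>I. lam i \<noteq> l}. (1 - [:0, 1 / (lam i - l):] ^ u) ^ us i)"
  proof (intro dvd_one_minus_prod dvd_one_minus_power)
    fix i
    have "[:0, 1 / (lam i - l):] = Polynomial.smult (1 / (lam i - l)) [:0, 1:]" by simp
    then have "[:0, 1:] ^ u dvd [:0, 1 / (lam i - l):] ^ u"
      by (metis smult_power dvd_smult dvd_refl)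
    then show "[:0, 1:] ^ u dvd 1 - (1 - [:0, 1 / (lam i - l):] ^ u)" by simp
  qed
qed

lemma mat_poly_prod_eq_mat_prod:
  assumes S: "S \<in> carrier_mat n n"
  shows "mat_poly (\<Prod>i\<in>{i\<in>{1..s}. P i}. (1 - [:0, c i:] ^ u) ^ m i) S =
    mat_prod n [(1\<^sub>m n - (c i \<cdot>\<^sub>m S) ^\<^sub>m u) ^\<^sub>m m i. i \<leftarrow> [1..<Suc s], P i]"
proof -
  have comprehension: "concat (map (\<lambda>i. if P i then [g i] else []) xs) = map g (filter P xs)"
    for g :: "nat \<Rightarrow> complex mat" and xs
    by (induction xs) auto
  have "{i\<in>{1..s}. P i} = set (filter P [1..<Suc s])" by auto
  then have "(\<Prod>i\<in>{i\<in>{1..s}. P i}. (1 - [:0, c i:] ^ u) ^ m i) =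
      (\<Prod>i\<leftarrow>filter P [1..<Suc s]. (1 - [:0, c i:] ^ u) ^ m i)"
    by (simp only: prod.distinct_set_conv_list distinct_filter distinct_upt)
  then show ?thesis
    by (simp only: mat_poly_prod_list[OF S] comprehension map_map o_def mat_poly_power[OF S]
        mat_poly_minus[OF S] mat_poly_1[OF S] mat_poly_X_scaled[OF S])
qed

theorem proposition2:
  fixes A :: "complex mat" and n s u :: nat
    and lam :: "nat \<Rightarrow> complex" and us :: "nat \<Rightarrow> nat"
  assumes "A \<in> carrier_mat n n"
    and "inj_on lam {1..s}"
    and "lam ` {1..s} = {l. eigenvalue A l}"
    and "\<forall>i\<in>{1..s}. us i \<ge> eigenvalue_index A (lam i)"
    and "u \<ge> mat_index A"
  shows "eigenprojection A =
           mat_prod n [(1\<^sub>m n - ((1 / lam i) \<cdot>\<^sub>m A) ^\<^sub>m u) ^\<^sub>m us i. i \<leftarrow> [1..<Suc s], lam i \<noteq> 0]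
       \<and> (\<forall>k\<in>{1..s}. \<forall>j<eigenvalue_index A (lam k).
            mat_component A (lam k) j =
              mat_prod n [(1\<^sub>m n - ((1 / (lam i - lam k)) \<cdot>\<^sub>m mat_shift A (lam k)) ^\<^sub>m us k) ^\<^sub>m us i.
                            i \<leftarrow> [1..<Suc s], i \<noteq> k]
              * (inverse (fact j) \<cdot>\<^sub>m (mat_shift A (lam k) ^\<^sub>m j)))"
proof (intro conjI ballI allI impI)
  note A = assms(1)
  have us: "\<And>i. i \<in> {1..s} \<Longrightarrow> eigenvalue_index A (lam i) \<le> us i" using assms(4) by blast
  have S: "mat_shift A l \<in> carrier_mat n n" for l using A by (rule mat_shift_carrier)
  have E: "eigenprojection (mat_shift A l) = mat_poly
      (\<Prod>i\<in>{i\<in>{1..s}. lam i \<noteq> l}. (1 - [:0, 1 / (lam i - l):] ^ w) ^ us i) (mat_shift A l)"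
    if "mat_index (mat_shift A l) \<le> w" for l w
    using A finite_atLeastAtMost assms(3) us that by (rule eigenprojection_mat_shift)
  {
    have A0: "mat_shift A 0 = A" using A by (auto simp: mat_shift_def intro!: eq_matI)
    show "eigenprojection A =
        mat_prod n [(1\<^sub>m n - ((1 / lam i) \<cdot>\<^sub>m A) ^\<^sub>m u) ^\<^sub>m us i. i \<leftarrow> [1..<Suc s], lam i \<noteq> 0]"
      using E[of 0 u] assms(5) by (simp only: A0 diff_zero mat_poly_prod_eq_mat_prod[OF A])
  }
  fix k j assume k: "k \<in> {1..s}"
  let ?S = "mat_shift A (lam k)"
  have filter_eq: "lam i = lam k \<longleftrightarrow> i = k" if "i \<in> {1..s}" for i
    using assms(2) k that by (auto dest: inj_onD)
  \<comment> \<open>Distinctness of the eigenvalues makes \<open>X^(us k)\<close> the exact power of \<open>X\<close> in the annihilator.\<close>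
  have "{i \<in> {1..s}. lam i = lam k} = {k}" using filter_eq k by auto
  moreover have "mat_poly ([:0, 1:] ^ (\<Sum>i\<in>{i\<in>{1..s}. lam i = lam k}. us i) *
      (\<Prod>i\<in>{i\<in>{1..s}. lam i \<noteq> lam k}. [:-(lam i - lam k), 1:] ^ us i)) ?S = 0\<^sub>m n n"
    using A finite_atLeastAtMost assms(3) us by (rule mat_shift_annihilator)
  ultimately have "mat_index ?S \<le> us k"
    using mat_index_le[OF S _ poly_shifted_eigenvalues_nonzero[OF finite_atLeastAtMost]] by fastforce
  then have E': "eigenprojection ?S = mat_poly (\<Prod>i\<in>{i\<in>{1..s}. lam i \<noteq> lam k}.
      (1 - [:0, 1 / (lam i - lam k):] ^ us k) ^ us i) ?S" by (rule E)
  have "{i\<in>{1..s}. lam i \<noteq> lam k} = {i\<in>{1..s}. i \<noteq> k}" using filter_eq by auto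
  with E' have E'': "eigenprojection ?S = mat_poly (\<Prod>i\<in>{i\<in>{1..s}. i \<noteq> k}.
      (1 - [:0, 1 / (lam i - lam k):] ^ us k) ^ us i) ?S" by (simp only:)
  define e where "e = (\<Prod>i\<in>{i\<in>{1..s}. i \<noteq> k}. (1 - [:0, 1 / (lam i - lam k):] ^ us k) ^ us i)"
  have e: "eigenprojection ?S = mat_poly e ?S" using E'' by (simp only: e_def)
  have e': "mat_poly e ?S =
      mat_prod n [(1\<^sub>m n - ((1 / (lam i - lam k)) \<cdot>\<^sub>m ?S) ^\<^sub>m us k) ^\<^sub>m us i. i \<leftarrow> [1..<Suc s], i \<noteq> k]"
    by (simp only: e_def mat_poly_prod_eq_mat_prod[OF S])
  have c: "mat_poly p ?S \<in> carrier_mat n n" for p using S by simp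
  have "mat_component A (lam k) j = inverse (fact j) \<cdot>\<^sub>m mat_poly ([:0, 1:] ^ j * e) ?S"
    by (simp only: mat_component_def eigenprojection_at_def e mat_poly_mult[OF S] mat_poly_X_power[OF S])
  \<comment> \<open>The eigenprojection is a polynomial in \<open>?S\<close>, so it commutes with the power of \<open>?S\<close>.\<close>
  also have "\<dots> = inverse (fact j) \<cdot>\<^sub>m (mat_poly e ?S * mat_poly ([:0, 1:] ^ j) ?S)"
    by (simp only: mult.commute[of _ e] mat_poly_mult[OF S])
  also have "\<dots> = mat_poly e ?S * (inverse (fact j) \<cdot>\<^sub>m (?S ^\<^sub>m j))"
    by (simp only: mult_smult_distrib[OF c c] flip: mat_poly_X_power[OF S])
  finally show "mat_component A (lam k) j =
      mat_prod n [(1\<^sub>m n - ((1 / (lam i - lam k)) \<cdot>\<^sub>m ?S) ^\<^sub>m us k) ^\<^sub>m us i. i \<leftarrow> [1..<Suc s], i \<noteq> k]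
        * (inverse (fact j) \<cdot>\<^sub>m (?S ^\<^sub>m j))"
    by (simp only: e')
qed

end
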